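(* Let $p$ be a prime number and $q>p$ an integer coprime to $p$. Let $m$ be a positive integer, and let $E_m\subset\mathbf{Q}\cap\mathbf{Z}_p$ be a set of representatives of the classes modulo $p^m$ (exactly one element in each class of $\mathbf{Z}_p/p^m\mathbf{Z}_p$), all of whose elements $u$ satisfy $H(u)>m$. Let $M(E_m)$ denote the mean of the quantities $H(u_m)-H(u)$ as $u$ runs over $E_m$, where $u_m=g_{p,q}^m(u)$. Then $$m\left(\frac{p-1}{p}\frac{\log q}{\log p}-1\right)-2\le M(E_m)\le m\left(\frac{p-1}{p}\frac{\log q}{\log p}-1\right)+2.$$
   Context: For $x\in\mathbf{Z}_p$, $\epsilon_0(x)\in\{0,1,\dots,p-1\}$ is the unique element with $\epsilon_0(x)\equiv x\pmod p$. The map $g_{p,q}:\mathbf{Z}_p\to\mathbf{Z}_p$ is defined by $g_{p,q}(x)=\frac{x}{p}$ if $p\mid x$ and $g_{p,q}(x)=\frac{qx+\epsilon_0(-qx)}{p}$ otherwise; $g_{p,q}^m$ is the $m$-th iterate. For a nonzero rational $u$, $H(u)$ is the integer satisfying $p^{H(u)-1}\le|u|<p^{H(u)}$, where $|\cdot|$ is the usual absolute value. *)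

theory Defs
  imports Complex_Main "HOL-Computational_Algebra.Primes" "HOL-Algebra.QuotRing" "HOL-Algebra.Divisibility"
begin

text \<open>The ring of \<open>p\<close>-adic integers, as the inverse limit of the rings \<open>\<int>/p\<^sup>n\<int>\<close>: an element is a
  compatible sequence of residues, its \<open>n\<close>-th entry being the representative in \<open>{0..<p ^ n}\<close> of
  its class modulo \<open>p ^ n\<close>.\<close>

definition padic_int_ring :: "int \<Rightarrow> (nat \<Rightarrow> int) ring" where
  "padic_int_ring p =
    \<lparr>carrier = {x. \<forall>n. x n \<in> {0..<p ^ n} \<and> x (Suc n) mod p ^ n = x n},
     mult = (\<lambda>x y n. (x n * y n) mod p ^ n),
     one = (\<lambda>n. 1 mod p ^ n),
     zero = (\<lambda>n. 0),
     add = (\<lambda>x y n. (x n + y n) mod p ^ n)\<rparr>"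

definition padic_of_int :: "int \<Rightarrow> int \<Rightarrow> nat \<Rightarrow> int" where
  "padic_of_int p k = (\<lambda>n. k mod p ^ n)"

definition padic_eps0 :: "int \<Rightarrow> (nat \<Rightarrow> int) \<Rightarrow> int" where
  "padic_eps0 p x =
    (THE e. e \<in> {0..p - 1} \<and>
       padic_of_int p p divides\<^bsub>padic_int_ring p\<^esub> (x \<ominus>\<^bsub>padic_int_ring p\<^esub> padic_of_int p e))"

definition padic_div_p :: "int \<Rightarrow> (nat \<Rightarrow> int) \<Rightarrow> nat \<Rightarrow> int" where
  "padic_div_p p x =
    (THE y. y \<in> carrier (padic_int_ring p) \<and> padic_of_int p p \<otimes>\<^bsub>padic_int_ring p\<^esub> y = x)"

definition g_map :: "int \<Rightarrow> int \<Rightarrow> (nat \<Rightarrow> int) \<Rightarrow> nat \<Rightarrow> int" where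
  "g_map p q x =
    (let R = padic_int_ring p; qx = padic_of_int p q \<otimes>\<^bsub>R\<^esub> x in
     if padic_of_int p p divides\<^bsub>R\<^esub> x then padic_div_p p x
     else padic_div_p p (qx \<oplus>\<^bsub>R\<^esub> padic_of_int p (padic_eps0 p (\<ominus>\<^bsub>R\<^esub> qx))))"

text \<open>The \<open>p\<close>-adic integer \<open>x\<close> equals the rational number \<open>u\<close>: with \<open>u = a / b\<close> in lowest terms,
  \<open>b x = a\<close>. For prime \<open>p\<close> there is at most one such \<open>u\<close>, as \<open>padic_int_ring p\<close> has characteristic zero.\<close>

definition padic_eq_rat :: "int \<Rightarrow> (nat \<Rightarrow> int) \<Rightarrow> rat \<Rightarrow> bool" where
  "padic_eq_rat p x u \<longleftrightarrow>
    (case quotient_of u of (a, b) \<Rightarrow>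
       padic_of_int p b \<otimes>\<^bsub>padic_int_ring p\<^esub> x = padic_of_int p a)"

definition rational_padic_ints :: "int \<Rightarrow> (nat \<Rightarrow> int) set" where
  "rational_padic_ints p = {x \<in> carrier (padic_int_ring p). \<exists>u. padic_eq_rat p x u}"

definition rat_of_padic :: "int \<Rightarrow> (nat \<Rightarrow> int) \<Rightarrow> rat" where
  "rat_of_padic p x = (THE u. padic_eq_rat p x u)"

text \<open>Only meaningful for \<open>u \<noteq> 0\<close> (and \<open>p > 1\<close>).\<close>

definition H_rat :: "int \<Rightarrow> rat \<Rightarrow> int" where
  "H_rat p u = (THE k. of_int p powi (k - 1) \<le> \<bar>u\<bar> \<and> \<bar>u\<bar> < of_int p powi k)"

abbreviation H_padic :: "int \<Rightarrow> (nat \<Rightarrow> int) \<Rightarrow> int" where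
  "H_padic p x \<equiv> H_rat p (rat_of_padic p x)"

definition residue_system :: "int \<Rightarrow> nat \<Rightarrow> (nat \<Rightarrow> int) set \<Rightarrow> bool" where
  "residue_system p m E \<longleftrightarrow>
    (\<forall>C \<in> carrier (padic_int_ring p Quot (PIdl\<^bsub>padic_int_ring p\<^esub> (padic_of_int p (p ^ m)))).
       \<exists>!u. u \<in> E \<and> u \<in> C)"

definition mean_H_gain :: "int \<Rightarrow> int \<Rightarrow> nat \<Rightarrow> (nat \<Rightarrow> int) set \<Rightarrow> real" where
  "mean_H_gain p q m E =
    (\<Sum>u\<in>E. of_int (H_padic p ((g_map p q ^^ m) u) - H_padic p u)) / of_nat (card E)"

end

theory Submission
  imports Defs "HOL-Number_Theory.Cong"
begin

text \<open>
  The map sends \<open>x\<close> to \<open>(c x + e) / p\<close> with \<open>(c, e) = (1, 0)\<close> if \<open>p\<close> divides \<open>x\<close>, and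
  \<open>c = q\<close>, \<open>0 < e < p\<close> otherwise. Composing \<open>m\<close> such steps from a rational \<open>u\<close> gives
  \<open>p\<^sup>m u\<^sub>m = q\<^sup>k u + s\<close>, where \<open>k\<close> counts the steps at which \<open>p\<close> does not divide. Each contribution
  to \<open>s\<close> is created by a step that also contributes a factor \<open>q\<close> to \<open>q\<^sup>k\<close>, so a geometric series
  gives \<open>0 \<le> s \<le> q\<^sup>k p\<^sup>m / q\<close> (lemma \<open>iterate_affine\<close>). The hypothesis \<open>H(u) > m\<close> says
  \<open>\<bar>u\<bar> \<ge> p\<^sup>m\<close>; hence \<open>s\<close> is at most a third of \<open>q\<^sup>k \<bar>u\<bar>\<close>, whatever the sign of \<open>u\<close>, and the
  logarithm of \<open>\<bar>u\<^sub>m\<bar> / \<bar>u\<bar>\<close> to base \<open>p\<close> differs from \<open>k log q / log p - m\<close> by less than 1. Rounding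
  to the integers \<open>H\<close> costs less than 1 more, which explains the constant 2 (lemma
  \<open>H_gain_bound\<close>).

  It remains to average \<open>k\<close>. It depends only on \<open>u\<close> modulo \<open>p\<^sup>m\<close>, and \<open>E\<close> is in bijection with the
  residues modulo \<open>p\<^sup>m\<close> (lemma \<open>residue_system_bij\<close>), so it can be computed with ordinary
  integers. On each of the \<open>p\<close> classes modulo \<open>p\<close> the map is affine with slope \<open>1\<close> or \<open>q\<close> in the
  variable \<open>y\<close> of \<open>p y + r\<close>. Both slopes are prime to \<open>p\<close>, so each class is carried bijectively onto
  the residues modulo \<open>p\<^sup>m\<^sup>-\<^sup>1\<close>: the map preserves equidistribution. Thus at every step a
  proportion \<open>(p - 1) / p\<close> of the residues is not divisible by \<open>p\<close>, and the mean of \<open>k\<close> is exactly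
  \<open>m (p - 1) / p\<close> (lemma \<open>sum_mult_steps\<close>).
\<close>

section \<open>The ring of p-adic integers\<close>

abbreviation carr :: "int \<Rightarrow> (nat \<Rightarrow> int) set" where
  "carr p \<equiv> carrier (padic_int_ring p)"

lemma mem_carr:
  "x \<in> carr p \<longleftrightarrow> (\<forall>n. x n \<in> {0..<p ^ n} \<and> x (Suc n) mod p ^ n = x n)"
  by (simp add: padic_int_ring_def)

lemma ring_ops:
  "x \<otimes>\<^bsub>padic_int_ring p\<^esub> y = (\<lambda>n. (x n * y n) mod p ^ n)"
  "x \<oplus>\<^bsub>padic_int_ring p\<^esub> y = (\<lambda>n. (x n + y n) mod p ^ n)"
  "\<one>\<^bsub>padic_int_ring p\<^esub> = (\<lambda>n. 1 mod p ^ n)"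
  "\<zero>\<^bsub>padic_int_ring p\<^esub> = (\<lambda>n. 0)"
  by (simp_all add: padic_int_ring_def)

lemma carr_mod_self: "x \<in> carr p \<Longrightarrow> x n mod p ^ n = x n"
  by (simp add: mem_carr)

lemma carr_mod_add: "x \<in> carr p \<Longrightarrow> x (n + m) mod p ^ n = x n"
proof (induction m)
  case 0
  then show ?case by (simp add: carr_mod_self)
next
  case (Suc m)
  have "x (n + Suc m) mod p ^ n = x (Suc (n + m)) mod p ^ (n + m) mod p ^ n"
    by (simp add: mod_mod_cancel le_imp_power_dvd)
  also have "\<dots> = x (n + m) mod p ^ n"
    using Suc.prems by (simp add: mem_carr)
  finally show ?case using Suc by simp
qed

lemma carr_cong:
  assumes "x \<in> carr p" "n \<le> m"
  shows "[x m = x n] (mod p ^ n)"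
  using carr_mod_add[OF assms(1), of n "m - n"] carr_mod_self[OF assms(1), of n] assms(2)
  by (simp add: cong_def)

lemma carrI_cong:
  assumes "p > 0" "\<And>n. [f (Suc n) = f n] (mod p ^ n)"
  shows "(\<lambda>n. f n mod p ^ n) \<in> carr p"
  using assms by (auto simp: mem_carr cong_def mod_mod_cancel le_imp_power_dvd)

lemma carr_eqI:
  assumes "x \<in> carr p" "y \<in> carr p" "\<And>n. [x n = y n] (mod p ^ n)"
  shows "x = y"
  using assms by (metis carr_mod_self cong_def ext)

lemma padic_of_int_carr: "p > 0 \<Longrightarrow> padic_of_int p k \<in> carr p"
  unfolding padic_of_int_def by (rule carrI_cong) auto

lemma padic_cring:
  assumes p: "p > 0"
  shows "cring (padic_int_ring p)"
proof (rule cringI)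
  show "abelian_group (padic_int_ring p)"
  proof (rule abelian_groupI)
    fix x y assume "x \<in> carr p" "y \<in> carr p"
    then show "x \<oplus>\<^bsub>padic_int_ring p\<^esub> y \<in> carr p"
      unfolding ring_ops by (intro carrI_cong p cong_add carr_cong) auto
  next
    show "\<zero>\<^bsub>padic_int_ring p\<^esub> \<in> carr p"
      using p by (simp add: ring_ops mem_carr)
  next
    fix x assume x: "x \<in> carr p"
    then show "\<zero>\<^bsub>padic_int_ring p\<^esub> \<oplus>\<^bsub>padic_int_ring p\<^esub> x = x"
      by (simp add: ring_ops carr_mod_self)
    have "(\<lambda>n. (- x n) mod p ^ n) \<in> carr p"
      using x by (intro carrI_cong p) (auto simp: cong_minus_minus_iff intro: carr_cong)
    then show "\<exists>y\<in>carr p. y \<oplus>\<^bsub>padic_int_ring p\<^esub> x = \<zero>\<^bsub>padic_int_ring p\<^esub>"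
      by (intro bexI[of _ "\<lambda>n. (- x n) mod p ^ n"]) (auto simp: ring_ops mod_simps)
  qed (auto simp: ring_ops mod_simps algebra_simps)
next
  show "comm_monoid (padic_int_ring p)"
  proof (rule comm_monoidI)
    fix x y assume "x \<in> carr p" "y \<in> carr p"
    then show "x \<otimes>\<^bsub>padic_int_ring p\<^esub> y \<in> carr p"
      unfolding ring_ops by (intro carrI_cong p cong_mult carr_cong) auto
  next
    show "\<one>\<^bsub>padic_int_ring p\<^esub> \<in> carr p"
      unfolding ring_ops by (intro carrI_cong p) auto
  next
    fix x assume x: "x \<in> carr p"
    then show "\<one>\<^bsub>padic_int_ring p\<^esub> \<otimes>\<^bsub>padic_int_ring p\<^esub> x = x"
      by (simp add: ring_ops carr_mod_self mod_simps)
  qed (auto simp: ring_ops mod_simps algebra_simps)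
qed (auto simp: ring_ops mod_simps algebra_simps)

lemma a_inv_entry:
  assumes p: "p > 0" and x: "x \<in> carr p"
  shows "(\<ominus>\<^bsub>padic_int_ring p\<^esub> x) n = (- x n) mod p ^ n"
proof -
  interpret cring "padic_int_ring p" by (rule padic_cring[OF p])
  have "(\<ominus>\<^bsub>padic_int_ring p\<^esub> x \<oplus>\<^bsub>padic_int_ring p\<^esub> x) n = 0"
    using x by (simp add: l_neg) (simp add: ring_ops)
  then have "[(\<ominus>\<^bsub>padic_int_ring p\<^esub> x) n = - x n] (mod p ^ n)"
    by (simp add: ring_ops cong_iff_dvd_diff mod_eq_0_iff_dvd)
  then show ?thesis
    using carr_mod_self[OF a_inv_closed[OF x], of n] by (simp add: cong_def)
qed

lemma a_minus_entry:
  assumes p: "p > 0" and "x \<in> carr p" "y \<in> carr p"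
  shows "(x \<ominus>\<^bsub>padic_int_ring p\<^esub> y) n = (x n - y n) mod p ^ n"
  using assms by (simp add: a_minus_def ring_ops a_inv_entry mod_simps)

text \<open>The quotient by \<open>p\<^sup>m\<close> has to be read off \<open>m\<close> places further along the sequence, because
  division loses \<open>m\<close> digits of precision.\<close>

lemma div_power_shift:
  assumes p: "p > 0" and x: "x \<in> carr p" and x0: "x m = 0"
  defines "y \<equiv> (\<lambda>n. x (n + m) div p ^ m)"
  shows "y \<in> carr p" "padic_of_int p (p ^ m) \<otimes>\<^bsub>padic_int_ring p\<^esub> y = x"
proof -
  have dvd: "p ^ m dvd x (n + m)" for n
    using carr_mod_add[OF x, of m n] x0 by (simp add: add.commute mod_eq_0_iff_dvd)
  then have eq: "p ^ m * y n = x (n + m)" for n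
    by (simp add: y_def)
  show y: "y \<in> carr p"
    unfolding mem_carr
  proof (intro allI conjI)
    fix n
    have "0 \<le> x (n + m)" "x (n + m) < p ^ (n + m)"
      using x by (auto simp: mem_carr)
    then have "0 \<le> p ^ m * y n" "p ^ m * y n < p ^ m * p ^ n"
      unfolding eq by (simp_all add: power_add mult.commute)
    then show "y n \<in> {0..<p ^ n}"
      using zero_less_power[OF p, of m] by (simp add: zero_le_mult_iff)
    have "p ^ m * y (Suc n) mod (p ^ m * p ^ n) = p ^ m * y n"
      using x unfolding eq by (simp add: mem_carr power_add[symmetric] add.commute)
    then show "y (Suc n) mod p ^ n = y n"
      using p by (simp add: mod_mult_mult1)
  qed
  show "padic_of_int p (p ^ m) \<otimes>\<^bsub>padic_int_ring p\<^esub> y = x"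
    using carr_mod_add[OF x]
    by (simp add: ring_ops padic_of_int_def mod_simps eq)
qed

lemma power_divides_iff:
  assumes p: "p > 0" and x: "x \<in> carr p"
  shows "padic_of_int p (p ^ m) divides\<^bsub>padic_int_ring p\<^esub> x \<longleftrightarrow> x m = 0"
proof
  assume "padic_of_int p (p ^ m) divides\<^bsub>padic_int_ring p\<^esub> x"
  then show "x m = 0"
    by (auto simp: factor_def ring_ops padic_of_int_def)
next
  assume "x m = 0"
  from div_power_shift[OF p x this]
  show "padic_of_int p (p ^ m) divides\<^bsub>padic_int_ring p\<^esub> x"
    unfolding factor_def by metis
qed

lemma p_divides_iff:
  assumes "p > 0" "x \<in> carr p"
  shows "padic_of_int p p divides\<^bsub>padic_int_ring p\<^esub> x \<longleftrightarrow> x 1 = 0"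
  using power_divides_iff[OF assms, of 1] by simp

lemma carr_first_bounds: "x \<in> carr p \<Longrightarrow> 0 \<le> x 1 \<and> x 1 < p"
  unfolding mem_carr by (metis atLeastLessThan_iff power_one_right)

lemma padic_eps0_eq:
  assumes p: "p > 0" and x: "x \<in> carr p"
  shows "padic_eps0 p x = x 1"
proof -
  interpret cring "padic_int_ring p" by (rule padic_cring[OF p])
  have *: "padic_of_int p p divides\<^bsub>padic_int_ring p\<^esub> (x \<ominus>\<^bsub>padic_int_ring p\<^esub> padic_of_int p e)
           \<longleftrightarrow> x 1 mod p = e mod p" for e
    using p x by (simp add: p_divides_iff padic_of_int_carr a_minus_entry)
      (simp add: padic_of_int_def mod_simps mod_eq_dvd_iff mod_eq_0_iff_dvd)
  show ?thesis
    unfolding padic_eps0_def *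
    using carr_first_bounds[OF x] by (intro the_equality) auto
qed

lemma padic_div_p_eq:
  assumes p: "p > 0" and x: "x \<in> carr p" and x0: "x 1 = 0"
  shows "padic_div_p p x \<in> carr p" "padic_div_p p x n = x (Suc n) div p"
proof -
  define y where "y = (\<lambda>n. x (n + 1) div p ^ 1)"
  have y: "y \<in> carr p" "padic_of_int p p \<otimes>\<^bsub>padic_int_ring p\<^esub> y = x"
    using div_power_shift[OF p x x0] by (simp_all add: y_def)
  have "padic_div_p p x = y"
    unfolding padic_div_p_def
  proof (intro the_equality conjI y)
    fix z assume z: "z \<in> carr p \<and> padic_of_int p p \<otimes>\<^bsub>padic_int_ring p\<^esub> z = x"
    show "z = y"
    proof (rule carr_eqI)
      fix n
      have "(padic_of_int p p \<otimes>\<^bsub>padic_int_ring p\<^esub> z) (Suc n)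
              = (padic_of_int p p \<otimes>\<^bsub>padic_int_ring p\<^esub> y) (Suc n)"
        using z y by simp
      then have "(p * z (Suc n)) mod (p * p ^ n) = (p * y (Suc n)) mod (p * p ^ n)"
        by (simp add: ring_ops padic_of_int_def mod_simps)
      then have "[z (Suc n) = y (Suc n)] (mod p ^ n)"
        using p by (simp add: mod_mult_mult1 cong_def)
      moreover have "[z (Suc n) = z n] (mod p ^ n)" "[y (Suc n) = y n] (mod p ^ n)"
        using z y by (auto intro: carr_cong)
      ultimately show "[z n = y n] (mod p ^ n)"
        by (meson cong_sym cong_trans)
    qed (use z y in auto)
  qed
  then show "padic_div_p p x \<in> carr p" "padic_div_p p x n = x (Suc n) div p"
    using y by (simp_all add: y_def)
qed

section \<open>The map on residues\<close>

text \<open>The remainder term vanishes when \<open>p\<close> divides \<open>z\<close>; with the multiplier taken to be 1 there,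
  one formula covers both branches of the map.\<close>

definition multiplier :: "int \<Rightarrow> int \<Rightarrow> int \<Rightarrow> int" where
  "multiplier p q z = (if p dvd z then 1 else q)"

definition int_map :: "int \<Rightarrow> int \<Rightarrow> int \<Rightarrow> int" where
  "int_map p q z = (let c = multiplier p q z in (c * z + (- (c * z)) mod p) div p)"

text \<open>Through this congruence, all questions about divisibility along the orbit of a \<open>p\<close>-adic integer
  become questions about integers; each step costs one digit of precision.\<close>

lemma g_map_entry:
  assumes p: "p > 0" and x: "x \<in> carr p"
  shows "g_map p q x \<in> carr p" (is ?A)
    and "[g_map p q x n = int_map p q (x (Suc n))] (mod p ^ n)" (is ?B)
proof -
  interpret cring "padic_int_ring p" by (rule padic_cring[OF p])
  define z where "z = x (Suc n)"
  have z1: "z mod p = x 1"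
    using carr_mod_add[OF x, of 1 n] by (simp add: z_def)
  then have dvd: "p dvd z \<longleftrightarrow> x 1 = 0"
    by (simp add: dvd_eq_mod_eq_0)
  have "?A \<and> ?B"
  proof (cases "x 1 = 0")
    case True
    then have g: "g_map p q x = padic_div_p p x"
      using p_divides_iff[OF p x] by (simp add: g_map_def Let_def)
    have "[padic_div_p p x n = int_map p q z] (mod p ^ n)"
      using padic_div_p_eq(2)[OF p x True, of n] True dvd
      by (simp add: int_map_def multiplier_def mod_minus_eq z_def dvd_minus_iff mod_0_imp_dvd
          dvd_imp_mod_0)
    then show ?thesis
      using padic_div_p_eq(1)[OF p x True] g by (simp add: z_def)
  next
    case False
    define qx where "qx = padic_of_int p q \<otimes>\<^bsub>padic_int_ring p\<^esub> x"
    have qx: "qx \<in> carr p"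
      using x p by (simp add: qx_def padic_of_int_carr)
    have qxn: "qx k = (q * x k) mod p ^ k" for k
      by (simp add: qx_def ring_ops padic_of_int_def mod_simps)
    define e where "e = (- (q * z)) mod p"
    have e: "padic_eps0 p (\<ominus>\<^bsub>padic_int_ring p\<^esub> qx) = e"
      using qx p z1 by (simp add: padic_eps0_eq a_inv_entry qxn e_def mod_simps)
        (metis mod_minus_eq mod_mult_right_eq z1)
    define w where "w = qx \<oplus>\<^bsub>padic_int_ring p\<^esub> padic_of_int p e"
    have w: "w \<in> carr p"
      using qx p by (simp add: w_def padic_of_int_carr)
    have wk: "w k = (q * x k + e) mod p ^ k" for k
      by (simp add: w_def ring_ops qxn padic_of_int_def mod_simps)
    have "(q * x 1 + e) mod p = (q * z + e) mod p"
      using z1 by (metis mod_add_left_eq mod_mult_right_eq)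
    also have "\<dots> = 0"
      by (simp add: e_def mod_simps)
    finally have w1: "w 1 = 0"
      by (simp add: wk)
    have g: "g_map p q x = padic_div_p p w"
      using p_divides_iff[OF p x] False e by (simp add: g_map_def Let_def qx_def w_def)
    have "padic_div_p p w n = ((q * z + e) mod (p * p ^ n)) div p"
      using padic_div_p_eq(2)[OF p w w1, of n] wk[of "Suc n"] by (simp add: z_def)
    also have "\<dots> = ((q * z + e) div p) mod p ^ n"
      using p by (simp add: zmod_zmult2_eq)
    also have "(q * z + e) div p = int_map p q z"
      using dvd False by (simp add: int_map_def multiplier_def e_def)
    finally show ?thesis
      using padic_div_p_eq(1)[OF p w w1] g by (simp add: z_def cong_def)
  qed
  then show ?A ?B by auto
qed

lemma int_map_eq:
  assumes "p > 0"
  shows "p * int_map p q z = multiplier p q z * z + (- (multiplier p q z * z)) mod p"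
proof -
  have "p dvd multiplier p q z * z + (- (multiplier p q z * z)) mod p"
    by (simp add: mod_simps dvd_eq_mod_eq_0)
  then show ?thesis by (simp add: int_map_def Let_def)
qed

lemma cong_p_power_Suc:
  assumes "[a = b] (mod p ^ Suc n)"
  shows "[a = (b::int)] (mod p)"
  using assms by (auto simp: cong_iff_dvd_diff dest: dvd_mult_left)

lemma multiplier_cong: "[a = b] (mod p) \<Longrightarrow> multiplier p q a = multiplier p q b"
  by (simp add: multiplier_def cong_dvd_iff)

lemma int_map_cong:
  assumes p: "p > 0" and ab: "[a = b] (mod p ^ Suc n)"
  shows "[int_map p q a = int_map p q b] (mod p ^ n)"
proof -
  have ab1: "[a = b] (mod p)"
    using ab by (rule cong_p_power_Suc)
  define c where "c = multiplier p q a"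
  have c: "multiplier p q b = c"
    using multiplier_cong[OF ab1] by (simp add: c_def)
  have "(- (c * a)) mod p = (- (c * b)) mod p"
    using ab1 by (metis cong_def cong_minus_minus_iff cong_scalar_left)
  then have "p * int_map p q a - p * int_map p q b = c * (a - b)"
    using int_map_eq[OF p, of q a] int_map_eq[OF p, of q b] 
    by (simp add: c c_def[symmetric] algebra_simps)
  moreover have "p * p ^ n dvd c * (a - b)"
    using ab by (simp add: cong_iff_dvd_diff)
  ultimately have "p * p ^ n dvd p * (int_map p q a - int_map p q b)"
    by (simp add: right_diff_distrib)
  then show ?thesis
    using p by (simp add: cong_iff_dvd_diff)
qed

fun mult_steps :: "int \<Rightarrow> int \<Rightarrow> nat \<Rightarrow> int \<Rightarrow> nat" where
  "mult_steps p q 0 z = 0"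
| "mult_steps p q (Suc n) z = (if p dvd z then 0 else 1) + mult_steps p q n (int_map p q z)"

lemma mult_steps_cong:
  assumes p: "p > 0" and ab: "[a = b] (mod p ^ n)"
  shows "mult_steps p q n a = mult_steps p q n b"
  using ab
proof (induction n arbitrary: a b)
  case (Suc n)
  then show ?case
    using int_map_cong[OF p Suc.prems, of q] cong_p_power_Suc[OF Suc.prems]
    by (simp add: cong_dvd_iff)
qed auto

lemma sum_residues_affine:
  fixes f :: "int \<Rightarrow> nat" and N :: int
  assumes N: "N > 0" and q: "coprime q N"
    and f: "\<And>a b. [a = b] (mod N) \<Longrightarrow> f a = f b"
  shows "(\<Sum>y\<in>{0..<N}. f (q * y + c)) = (\<Sum>y\<in>{0..<N}. f y)"
proof -
  define h where "h y = (q * y + c) mod N" for y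
  have inj: "inj_on h {0..<N}"
  proof (rule inj_onI)
    fix x y assume xy: "x \<in> {0..<N}" "y \<in> {0..<N}" "h x = h y"
    then have "[q * x + c = q * y + c] (mod N)"
      by (simp add: h_def cong_def)
    then have "[x = y] (mod N)"
      using q by (simp add: cong_add_rcancel cong_mult_lcancel)
    then show "x = y"
      using xy by (simp add: cong_def)
  qed
  have "h ` {0..<N} \<subseteq> {0..<N}"
    using N by (auto simp: h_def)
  then have "bij_betw h {0..<N} {0..<N}"
    using inj by (simp add: bij_betw_def endo_inj_surj)
  then have "(\<Sum>y\<in>{0..<N}. f (h y)) = (\<Sum>y\<in>{0..<N}. f y)"
    by (rule sum.reindex_bij_betw)
  moreover have "f (h y) = f (q * y + c)" for y
    by (rule f) (simp add: h_def cong_def)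
  ultimately show ?thesis by simp
qed

lemma sum_split_mod:
  fixes f :: "int \<Rightarrow> nat" and p N :: int
  assumes p: "p > 0" and N: "N > 0"
  shows "(\<Sum>x\<in>{0..<p * N}. f x) = (\<Sum>r\<in>{0..<p}. \<Sum>y\<in>{0..<N}. f (p * y + r))"
proof -
  have "(\<Sum>r\<in>{0..<p}. \<Sum>y\<in>{0..<N}. f (p * y + r))
        = (\<Sum>(r, y)\<in>{0..<p} \<times> {0..<N}. f (p * y + r))"
    by (simp add: sum.cartesian_product)
  also have "\<dots> = (\<Sum>x\<in>{0..<p * N}. f x)"
  proof (rule sum.reindex_bij_witness[where i = "\<lambda>x. (x mod p, x div p)" 
                                        and j = "\<lambda>(r, y). p * y + r"])
    fix x assume x: "x \<in> {0..<p * N}"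
    have "x div p * p \<le> x"
      using p by (simp add: minus_mod_eq_div_mult[symmetric])
    also have "x < N * p"
      using x by (simp add: mult.commute)
    finally have "x div p < N"
      using p by simp
    then show "(x mod p, x div p) \<in> {0..<p} \<times> {0..<N}"
      using x p by (auto simp: pos_imp_zdiv_nonneg_iff)
  next
    fix a assume a: "a \<in> {0..<p} \<times> {0..<N}"
    obtain r y where ry: "a = (r, y)" by force
    have "p * y \<le> p * (N - 1)"
      using a ry p by (intro mult_left_mono) auto
    then show "(case a of (r, y) \<Rightarrow> p * y + r) \<in> {0..<p * N}"
      using a p ry by (auto simp: algebra_simps)
  qed (use p in auto)
  finally show ?thesis by simp
qed

text \<open>Equidistribution is preserved: each of the \<open>p\<close> classes modulo \<open>p\<close> is mapped affinely, with slope
  prime to \<open>p\<close>, onto all residues modulo \<open>p\<^sup>n\<close>, so every residue has exactly \<open>p\<close> preimages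
  modulo \<open>p\<^sup>n\<^sup>+\<^sup>1\<close>.\<close>

lemma sum_int_map:
  fixes f :: "int \<Rightarrow> nat"
  assumes p: "p > 0" and q: "coprime q p"
    and f: "\<And>a b. [a = b] (mod p ^ n) \<Longrightarrow> f a = f b"
  shows "(\<Sum>x\<in>{0..<p ^ Suc n}. f (int_map p q x)) = nat p * (\<Sum>y\<in>{0..<p ^ n}. f y)"
proof -
  have "(\<Sum>y\<in>{0..<p ^ n}. f (int_map p q (p * y + r))) = (\<Sum>y\<in>{0..<p ^ n}. f y)" for r
  proof -
    define c where "c = multiplier p q r"
    have c: "multiplier p q (p * y + r) = c" for y
      unfolding c_def by (rule multiplier_cong) (simp add: cong_def)
    have "p * int_map p q (p * y + r) = p * (c * y + int_map p q r)" for y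
    proof -
      have "(- (c * (p * y + r))) mod p = (- (c * r)) mod p"
        by (metis c_def cong_def cong_minus_minus_iff cong_scalar_left mod_mult_self4)
      then show ?thesis
        using int_map_eq[OF p, of q "p * y + r"] int_map_eq[OF p, of q r]
        unfolding c c_def[symmetric] by (simp add: distrib_left mult.left_commute)
    qed
    then have "int_map p q (p * y + r) = c * y + int_map p q r" for y
      using p by simp
    moreover have "coprime c (p ^ n)"
      using q by (auto simp: c_def multiplier_def)
    ultimately show ?thesis
      using sum_residues_affine[of "p ^ n" c f] f p by simp
  qed
  then show ?thesis
    using sum_split_mod[of p "p ^ n" "\<lambda>x. f (int_map p q x)"] p by simp
qed

lemma card_not_dvd:
  assumes p: "(p::int) > 0"
  shows "(\<Sum>x\<in>{0..<p ^ Suc n}. if p dvd x then 0 else 1) = nat (p - 1) * nat (p ^ n)"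
proof -
  have "(\<Sum>x\<in>{0..<p ^ Suc n}. if p dvd x then 0 else 1 :: nat)
        = (\<Sum>r\<in>{0..<p}. \<Sum>y\<in>{0..<p ^ n}. if p dvd r then 0 else 1)"
    using sum_split_mod[of p "p ^ n"] p by (simp add: dvd_add_right_iff)
  also have "\<dots> = (\<Sum>r\<in>{0..<p}. if r = 0 then 0 else nat (p ^ n))"
  proof (rule sum.cong)
    fix r assume "r \<in> {0..<p}"
    then have "p dvd r \<longleftrightarrow> r = 0" using zdvd_not_zless[of r p] by force
    then show "(\<Sum>y\<in>{0..<p ^ n}. if p dvd r then 0 else 1) = (if r = 0 then 0 else nat (p ^ n))"
      by simp
  qed simp
  also have "\<dots> = (\<Sum>r\<in>{0..<p} - {0}. nat (p ^ n))"
    by (rule sum.mono_neutral_cong_right) auto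
  also have "\<dots> = nat (p - 1) * nat (p ^ n)"
    using p by (simp add: card_Diff_subset nat_diff_distrib)
  finally show ?thesis .
qed

lemma sum_mult_steps:
  assumes p: "p > 0" and q: "coprime q p"
  shows "real_of_int p * real (\<Sum>x\<in>{0..<p ^ n}. mult_steps p q n x) = real n * (real_of_int p - 1) * real_of_int p ^ n"
proof (induction n)
  case (Suc n)
  have "(\<Sum>x\<in>{0..<p ^ Suc n}. mult_steps p q (Suc n) x)
      = nat (p - 1) * nat (p ^ n) + nat p * (\<Sum>x\<in>{0..<p ^ n}. mult_steps p q n x)"
    using card_not_dvd[OF p, of n]
      sum_int_map[OF p q, where n = n and f = "mult_steps p q n", OF mult_steps_cong[OF p]]
    by (simp add: sum.distrib)
  then have *: "real (\<Sum>x\<in>{0..<p ^ Suc n}. mult_steps p q (Suc n) x)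
      = (real_of_int p - 1) * real_of_int p ^ n + real_of_int p * real (\<Sum>x\<in>{0..<p ^ n}. mult_steps p q n x)"
    using p by simp
  have "real_of_int p * ((real_of_int p - 1) * real_of_int p ^ n
        + real n * (real_of_int p - 1) * real_of_int p ^ n)
      = real (Suc n) * (real_of_int p - 1) * real_of_int p ^ Suc n"
    by (simp add: algebra_simps)
  then show ?case
    unfolding * Suc.IH .
qed simp

section \<open>Rational trajectories\<close>

text \<open>The fraction \<open>a / b\<close> need not be in lowest terms: the denominator then stays the same along the
  whole orbit, and since it is prime to \<open>p\<close> common factors can be cancelled modulo \<open>p\<^sup>n\<close>.\<close>

definition represents :: "int \<Rightarrow> (nat \<Rightarrow> int) \<Rightarrow> int \<Rightarrow> int \<Rightarrow> bool" where
  "represents p x a b \<longleftrightarrow> b > 0 \<and> coprime b p \<and> (\<forall>n. [b * x n = a] (mod p ^ n))"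

lemma padic_eq_rat_iff:
  "padic_eq_rat p x u \<longleftrightarrow>
    (\<forall>n. [snd (quotient_of u) * x n = fst (quotient_of u)] (mod p ^ n))"
  by (auto simp: padic_eq_rat_def case_prod_unfold ring_ops padic_of_int_def mod_simps
      fun_eq_iff cong_def)

text \<open>If \<open>p\<close> divided the denominator, reducing \<open>b x = a\<close> modulo \<open>p\<close> would make it divide the
  numerator as well.\<close>

lemma represents_quotient_of:
  assumes p: "Factorial_Ring.prime p" and u: "padic_eq_rat p x u"
  shows "represents p x (fst (quotient_of u)) (snd (quotient_of u))"
proof -
  obtain a b where ab: "quotient_of u = (a, b)" by force
  have c: "[b * x n = a] (mod p ^ n)" for n
    using u ab by (simp add: padic_eq_rat_iff)
  have "coprime p b"
  proof (rule prime_imp_coprime[OF p], rule notI)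
    assume "p dvd b"
    moreover have "[b * x 1 = a] (mod p)"
      using c[of 1] by simp
    ultimately have "p dvd a"
      by (metis cong_dvd_iff dvd_mult2)
    then show False
      using \<open>p dvd b\<close> quotient_of_coprime[OF ab] p
      by (meson coprime_common_divisor not_prime_unit)
  qed
  then show ?thesis
    using c ab quotient_of_denom_pos[OF ab] by (simp add: represents_def coprime_commute)
qed

lemma padic_eq_rat_of_represents:
  assumes r: "represents p x a b"
  shows "padic_eq_rat p x (Fract a b)"
proof -
  obtain a' b' where q: "quotient_of (Fract a b) = (a', b')" by force
  have b: "b > 0" "coprime b p" "\<And>n. [b * x n = a] (mod p ^ n)"
    using r by (auto simp: represents_def)
  have b': "b' > 0"
    using q quotient_of_denom_pos by blast
  have "Fract a b = Fract a' b'"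
    using q by (metis Fract_of_int_quotient quotient_of_div)
  then have eq: "a * b' = a' * b"
    using b b' by (simp add: eq_rat)
  have "[b' * x n = a'] (mod p ^ n)" for n
  proof -
    have "[b' * (b * x n) = b' * a] (mod p ^ n)"
      using b by (intro cong_scalar_left) auto
    then have "[b * (b' * x n) = b * a'] (mod p ^ n)"
      using eq by (simp add: algebra_simps)
    then show ?thesis
      using b by (simp add: cong_mult_lcancel)
  qed
  then show ?thesis using q by (simp add: padic_eq_rat_iff)
qed

lemma int_eq_0_if_powers_dvd:
  fixes k p :: int
  assumes p: "p > 1" and d: "\<And>n. p ^ n dvd k"
  shows "k = 0"
proof (rule ccontr)
  assume "k \<noteq> 0"
  then have "\<bar>p ^ nat \<bar>k\<bar>\<bar> \<le> \<bar>k\<bar>"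
    using d[of "nat \<bar>k\<bar>"] dvd_imp_le_int by blast
  moreover have "int (nat \<bar>k\<bar>) < 2 ^ nat \<bar>k\<bar>"
    using of_nat_less_two_power by blast
  moreover have "(2::int) ^ nat \<bar>k\<bar> \<le> p ^ nat \<bar>k\<bar>"
    using p by (intro power_mono) auto
  ultimately show False by auto
qed

lemma padic_eq_rat_unique:
  assumes p: "p > 1" and u: "padic_eq_rat p x u" and v: "padic_eq_rat p x v"
  shows "u = v"
proof -
  obtain a b where ab: "quotient_of u = (a, b)" by force
  obtain c d where cd: "quotient_of v = (c, d)" by force
  have "p ^ n dvd a * d - c * b" for n
  proof -
    have 1: "[b * x n = a] (mod p ^ n)" "[d * x n = c] (mod p ^ n)"
      using u v ab cd by (auto simp: padic_eq_rat_iff)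
    have "[d * (b * x n) = d * a] (mod p ^ n)" "[b * (d * x n) = b * c] (mod p ^ n)"
      using 1 by (auto intro: cong_scalar_left)
    then have "[d * a = b * c] (mod p ^ n)"
      by (metis cong_sym cong_trans mult.left_commute)
    then show ?thesis by (simp add: cong_iff_dvd_diff mult.commute)
  qed
  then have "a * d = c * b"
    using int_eq_0_if_powers_dvd[OF p, of "a * d - c * b"] by simp
  moreover have "b > 0" "d > 0"
    using ab cd quotient_of_denom_pos by blast+
  moreover have "u = Fract a b" "v = Fract c d"
    using ab cd by (simp_all add: quotient_of_div Fract_of_int_quotient)
  ultimately show ?thesis by (simp add: eq_rat)
qed

lemma rat_of_padic_eq:
  assumes p: "p > 1" and r: "represents p x a b"
  shows "rat_of_padic p x = Fract a b"
  unfolding rat_of_padic_def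
  using padic_eq_rat_of_represents[OF r] padic_eq_rat_unique[OF p]
  by (intro the_equality) auto

lemma represents_g_map:
  fixes p q a b :: int
  assumes p: "p > 0" and x: "x \<in> carr p" and r: "represents p x a b"
  defines "c \<equiv> multiplier p q (x 1)"
  defines "e \<equiv> (- (c * x 1)) mod p"
  obtains a' where "represents p (g_map p q x) a' b" "p * a' = c * a + e * b"
proof -
  have b: "b > 0" "coprime b p" "\<And>n. [b * x n = a] (mod p ^ n)"
    using r by (auto simp: represents_def)
  have step: "[b * (p * g_map p q x n) = c * a + e * b] (mod p * p ^ n)" for n
  proof -
    define z where "z = x (Suc n)"
    have z1: "[z = x 1] (mod p)"
      using carr_cong[OF x, of 1 "Suc n"] by (simp add: z_def)
    have "[p * g_map p q x n = p * int_map p q z] (mod p * p ^ n)"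
      using g_map_entry(2)[OF p x, of q n] by (simp add: z_def cong_cmult_leftI)
    also have "p * int_map p q z = c * z + (- (c * z)) mod p"
      using int_map_eq[OF p, of q z] multiplier_cong[OF z1] by (simp add: c_def)
    also have "(- (c * z)) mod p = e"
      unfolding e_def using z1 by (metis cong_def cong_minus_minus_iff cong_scalar_left)
    finally have "[b * (p * g_map p q x n) = b * (c * z + e)] (mod p * p ^ n)"
      by (rule cong_scalar_left)
    also have "b * (c * z + e) = c * (b * z) + e * b"
      by (simp add: algebra_simps)
    also have "[\<dots> = c * a + e * b] (mod p * p ^ n)"
      using b(3)[of "Suc n"] by (intro cong_add cong_scalar_left) (auto simp: z_def)
    finally show ?thesis .
  qed
  have "p dvd c * a + e * b"
    using step[of 0] cong_dvd_iff[of "b * (p * g_map p q x 0)" "c * a + e * b" p] by simp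
  then obtain a' where a': "c * a + e * b = p * a'" by (elim dvdE)
  have "[b * g_map p q x n = a'] (mod p ^ n)" for n
  proof -
    have "p * p ^ n dvd p * (b * g_map p q x n - a')"
      using step[of n] a' by (simp add: cong_iff_dvd_diff algebra_simps)
    then show ?thesis
      using p by (simp add: cong_iff_dvd_diff)
  qed
  then show ?thesis
    using that[of a'] a' b by (simp add: represents_def)
qed

text \<open>In the bound on \<open>s\<close>, a step with multiplier \<open>q\<close> and remainder \<open>e \<le> p - 1\<close> turns
  \<open>q\<^sup>k (p\<^sup>n - 1)\<close> into at most \<open>q\<^sup>k\<^sup>+\<^sup>1 ((p - 1) + p (p\<^sup>n - 1))\<close>, which telescopes to
  \<open>q\<^sup>k\<^sup>+\<^sup>1 (p\<^sup>n\<^sup>+\<^sup>1 - 1)\<close>. The extra factor \<open>q\<close> on the left is what makes \<open>s\<close> small compared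
  with \<open>q\<^sup>k p\<^sup>n\<close>; it is available because a remainder appears only together with a multiplier
  \<open>q\<close>.\<close>

lemma iterate_affine:
  assumes p: "p > 0" and q: "q \<ge> 1" and x: "x \<in> carr p" and r: "represents p x a b"
  obtains a' s where "represents p ((g_map p q ^^ n) x) a' b"
    "p ^ n * a' = q ^ mult_steps p q n (x n) * a + s * b"
    "0 \<le> s" "q * s \<le> q ^ mult_steps p q n (x n) * (p ^ n - 1)"
proof -
  have "\<exists>a' s. represents p ((g_map p q ^^ n) x) a' b \<and>
    p ^ n * a' = q ^ mult_steps p q n (x n) * a + s * b \<and>
    0 \<le> s \<and> q * s \<le> q ^ mult_steps p q n (x n) * (p ^ n - 1)"
    using x r
  proof (induction n arbitrary: x a)
    case 0
    then show ?case by (intro exI[of _ a] exI[of _ 0]) auto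
  next
    case (Suc n)
    define c where "c = multiplier p q (x 1)"
    define e where "e = (- (c * x 1)) mod p"
    define y where "y = g_map p q x"
    define k where "k = mult_steps p q n (y n)"
    obtain a1 where a1: "represents p y a1 b" "p * a1 = c * a + e * b"
      using represents_g_map[OF p Suc.prems] unfolding y_def c_def e_def by metis
    have y: "y \<in> carr p"
      using g_map_entry(1)[OF p Suc.prems(1)] by (simp add: y_def)
    obtain a' s where IH: "represents p ((g_map p q ^^ n) y) a' b"
      "p ^ n * a' = q ^ k * a1 + s * b" "0 \<le> s" "q * s \<le> q ^ k * (p ^ n - 1)"
      using Suc.IH[OF y a1(1)] unfolding k_def by blast
    have e: "0 \<le> e" "e \<le> p - 1"
      using p pos_mod_bound[OF p, of "- (c * x 1)"] by (simp_all add: e_def)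
    define K where "K = mult_steps p q (Suc n) (x (Suc n))"
    have x1: "[x (Suc n) = x 1] (mod p)"
      using carr_cong[OF Suc.prems(1), of 1 "Suc n"] by simp
    have "mult_steps p q n (int_map p q (x (Suc n))) = k"
      unfolding k_def using g_map_entry(2)[OF p Suc.prems(1), of q n]
      by (intro mult_steps_cong[OF p]) (simp add: y_def cong_sym)
    then have K: "K = (if p dvd x 1 then 0 else 1) + k"
      using cong_dvd_iff[OF x1] by (simp add: K_def)
    have "p ^ Suc n * a' = q ^ k * (p * a1) + p * s * b"
      using arg_cong[OF IH(2), of "\<lambda>t. p * t"] by (simp add: algebra_simps)
    also have "\<dots> = q ^ k * c * a + (q ^ k * e + p * s) * b"
      using a1(2) by (simp add: algebra_simps)
    also have "q ^ k * c = q ^ K"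
      by (simp add: K c_def multiplier_def)
    finally have 1: "p ^ Suc n * a' = q ^ K * a + (q ^ k * e + p * s) * b" .
    have 2: "q * (q ^ k * e + p * s) \<le> q ^ K * (p ^ Suc n - 1)"
    proof (cases "p dvd x 1")
      case True
      then have "e = 0" by (simp add: e_def mod_0_imp_dvd dvd_imp_mod_0)
      then have "q * (q ^ k * e + p * s) = p * (q * s)" by simp
      also have "\<dots> \<le> p * (q ^ k * (p ^ n - 1))"
        using IH p by (intro mult_left_mono) auto
      also have "\<dots> = q ^ k * (p ^ Suc n - p)"
        by (simp add: algebra_simps)
      also have "\<dots> \<le> q ^ k * (p ^ Suc n - 1)"
        using p q by (intro mult_left_mono) auto
      finally show ?thesis using True by (simp add: K)
    next
      case False
      have "q * (q ^ k * e + p * s) = q ^ Suc k * e + p * (q * s)"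
        by (simp add: algebra_simps)
      also have "\<dots> \<le> q ^ Suc k * (p - 1) + p * (q ^ Suc k * (p ^ n - 1))"
      proof (intro add_mono mult_left_mono)
        have "q ^ k * (p ^ n - 1) \<le> q ^ Suc k * (p ^ n - 1)"
          using q p by (intro mult_right_mono power_increasing) auto
        then show "q * s \<le> q ^ Suc k * (p ^ n - 1)"
          using IH by linarith
      qed (use e p q in auto)
      also have "\<dots> = q ^ Suc k * (p ^ Suc n - 1)"
        by (simp add: algebra_simps)
      finally show ?thesis using False by (simp add: K)
    qed
    have "(g_map p q ^^ Suc n) x = (g_map p q ^^ n) y"
      by (simp add: y_def funpow_swap1)
    moreover have "0 \<le> q ^ k * e + p * s"
      using IH e p q by simp
    ultimately show ?case
      using 1 2 IH(1) unfolding K_def by metis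
  qed
  then show ?thesis using that by blast
qed

section \<open>Heights\<close>

lemma H_rat_eq_floor:
  assumes p: "p > 1" and u: "u \<noteq> 0"
  shows "H_rat p u = \<lfloor>log (real_of_int p) \<bar>real_of_rat u\<bar>\<rfloor> + 1"
proof -
  define L where "L = log (real_of_int p) \<bar>real_of_rat u\<bar>"
  have u': "\<bar>real_of_rat u\<bar> > 0" using u by simp
  have P: "real_of_int p > 1" using p by simp
  have pw: "real_of_rat (of_int p powi k) = real_of_int p powr of_int k" for k
    using p by (simp add: powr_real_of_int' power_int_def of_rat_power of_rat_inverse)
  have le: "of_int p powi k \<le> \<bar>u\<bar> \<longleftrightarrow> of_int k \<le> L" for k
  proof -
    have "of_int p powi k \<le> \<bar>u\<bar> \<longleftrightarrow> real_of_int p powr of_int k \<le> \<bar>real_of_rat u\<bar>"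
      unfolding pw[symmetric] by (metis abs_of_rat of_rat_less_eq)
    then show ?thesis using P u' by (simp add: L_def le_log_iff)
  qed
  have lt: "\<bar>u\<bar> < of_int p powi k \<longleftrightarrow> L < of_int k" for k
    using le[of k] by linarith
  show ?thesis
    unfolding H_rat_def le lt L_def[symmetric]
    by (rule the_equality) (linarith, linarith)
qed

text \<open>Since \<open>q \<ge> 3\<close> and \<open>\<bar>u\<bar> \<ge> p\<^sup>m\<close>, the remainder \<open>s\<close> is at most a third of \<open>q\<^sup>k \<bar>u\<bar>\<close>. So
  \<open>p\<^sup>m \<bar>u\<^sub>m\<bar>\<close> and \<open>q\<^sup>k \<bar>u\<bar>\<close> differ by a factor less than \<open>2 \<le> p\<close>, even if \<open>u\<close> is negative and
  \<open>s\<close> causes cancellation.\<close>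

lemma H_gain_bound:
  assumes p: "Factorial_Ring.prime p" and q: "q > p" and x: "x \<in> rational_padic_ints p"
    and u0: "rat_of_padic p x \<noteq> 0" and H: "H_padic p x > int m"
  shows "\<bar>real_of_int (H_padic p ((g_map p q ^^ m) x) - H_padic p x)
          - (real (mult_steps p q m (x m)) * (ln (real_of_int q) / ln (real_of_int p)) - real m)\<bar> \<le> 2"
proof -
  have p1: "p > 1" using p by (simp add: prime_gt_1_int)
  obtain u where xc: "x \<in> carr p" and u: "padic_eq_rat p x u"
    using x by (auto simp: rational_padic_ints_def)
  define a b where "a = fst (quotient_of u)" and "b = snd (quotient_of u)"
  have ab: "represents p x a b"
    using represents_quotient_of[OF p u] by (simp add: a_def b_def)
  then have b: "b > 0" by (simp add: represents_def)
  define k where "k = mult_steps p q m (x m)"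
  have pos: "p > 0" "q \<ge> 1" using p1 q by auto
  obtain a' s where s: "represents p ((g_map p q ^^ m) x) a' b"
    "p ^ m * a' = q ^ k * a + s * b" "0 \<le> s" "q * s \<le> q ^ k * (p ^ m - 1)"
    using iterate_affine[OF pos xc ab] unfolding k_def by metis
  define P Q U V S where "P = real_of_int p" and "Q = real_of_int q"
    and "U = real_of_int a / real_of_int b" and "V = real_of_int a' / real_of_int b"
    and "S = real_of_int s"
  have PQ: "P \<ge> 2" "Q \<ge> 3" using p1 q by (auto simp: P_def Q_def)
  have ru: "rat_of_padic p x = Fract a b" "rat_of_padic p ((g_map p q ^^ m) x) = Fract a' b"
    using rat_of_padic_eq[OF p1] ab s by auto
  have rr: "real_of_rat (Fract a b) = U" "real_of_rat (Fract a' b) = V"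
    using b by (simp_all add: U_def V_def of_rat_rat)
  have "real_of_int (p ^ m * a') = real_of_int (q ^ k * a + s * b)"
    using s by simp
  then have PV: "P ^ m * V = Q ^ k * U + S"
    using b by (simp add: P_def Q_def U_def V_def S_def field_simps)
  have "real_of_int (q * s) \<le> real_of_int (q ^ k * (p ^ m - 1))"
    using s by linarith
  then have "Q * S \<le> Q ^ k * (P ^ m - 1)"
    by (simp add: P_def Q_def S_def)
  also have "\<dots> \<le> Q ^ k * P ^ m"
    using PQ by (intro mult_left_mono) auto
  finally have QS: "Q * S \<le> Q ^ k * P ^ m" .
  have U0: "U \<noteq> 0" using u0 ru rr by (metis of_rat_eq_0_iff)
  have HU: "H_padic p x = \<lfloor>log P \<bar>U\<bar>\<rfloor> + 1"
    using H_rat_eq_floor[OF p1 u0] ru rr by (simp add: P_def)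
  have "real m \<le> log P \<bar>U\<bar>" using HU H by linarith
  then have Um: "P ^ m \<le> \<bar>U\<bar>"
    using PQ U0 by (simp add: le_log_iff powr_realpow)
  define W where "W = Q ^ k * \<bar>U\<bar>"
  have W: "W > 0" using PQ U0 by (simp add: W_def)
  have "Q ^ k * P ^ m \<le> W"
    unfolding W_def using Um PQ by (intro mult_left_mono) auto
  then have "Q * S \<le> W"
    using QS by linarith
  moreover have "3 * S \<le> Q * S"
    using PQ s by (intro mult_right_mono) (auto simp: S_def)
  ultimately have S: "0 \<le> S" "3 * S \<le> W"
    using s by (auto simp: S_def)
  have "\<bar>Q ^ k * U\<bar> = W"
    using PQ by (simp add: W_def abs_mult)
  then have VW: "P ^ m * \<bar>V\<bar> \<le> W + S" "W - S \<le> P ^ m * \<bar>V\<bar>"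
    using PV S PQ abs_mult[of "P ^ m" V] by auto
  have V0: "V \<noteq> 0" using VW S W by auto
  have "P ^ m * \<bar>V\<bar> < 2 * W" "W < 2 * (P ^ m * \<bar>V\<bar>)"
    using VW S W by linarith+
  moreover have "2 * W \<le> P * W" "2 * (P ^ m * \<bar>V\<bar>) \<le> P * (P ^ m * \<bar>V\<bar>)"
    using PQ W by (intro mult_right_mono; simp)+
  ultimately have "P ^ m * \<bar>V\<bar> < P * W" "W < P * (P ^ m * \<bar>V\<bar>)"
    by linarith+
  then have "log P (P ^ m * \<bar>V\<bar>) < log P (P * W)" "log P W < log P (P * (P ^ m * \<bar>V\<bar>))"
    using PQ W V0 by (simp_all add: zero_less_mult_iff)
  moreover have "log P (P ^ m * \<bar>V\<bar>) = real m + log P \<bar>V\<bar>"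
    "log P (P * W) = 1 + log P W"
    "log P (P * (P ^ m * \<bar>V\<bar>)) = 1 + (real m + log P \<bar>V\<bar>)"
    "log P W = real k * log P Q + log P \<bar>U\<bar>"
    using PQ W V0 U0 by (simp_all add: log_mult log_nat_power W_def)
  ultimately have log_gain: "\<bar>log P \<bar>V\<bar> - log P \<bar>U\<bar> - (real k * log P Q - real m)\<bar> < 1"
    by linarith
  have HV: "H_padic p ((g_map p q ^^ m) x) = \<lfloor>log P \<bar>V\<bar>\<rfloor> + 1"
    using H_rat_eq_floor[OF p1, of "Fract a' b"] ru rr V0 by (auto simp: P_def)
  have L: "log P Q = ln (real_of_int q) / ln (real_of_int p)"
    by (simp add: log_def P_def Q_def)
  have "\<bar>real_of_int \<lfloor>log P \<bar>V\<bar>\<rfloor> - real_of_int \<lfloor>log P \<bar>U\<bar>\<rfloor> - t\<bar> \<le> 2"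
    if "\<bar>log P \<bar>V\<bar> - log P \<bar>U\<bar> - t\<bar> < 1" for t
    using that floor_correct[of "log P \<bar>V\<bar>"] floor_correct[of "log P \<bar>U\<bar>"]
    unfolding of_int_add of_int_1 abs_less_iff abs_le_iff by argo
  from this[OF log_gain] show ?thesis
    by (simp add: HU HV L k_def)
qed

section \<open>Complete residue systems and the mean\<close>

text \<open>The cosets of the principal ideal generated by \<open>p\<^sup>m\<close> are the fibres of the projection to the
  \<open>m\<close>-th entry.\<close>

lemma residue_system_bij:
  assumes p: "p > 0" and E: "E \<subseteq> carr p" and R: "residue_system p m E"
  shows "bij_betw (\<lambda>u. u m) E {0..<p ^ m}"
proof -
  interpret cring "padic_int_ring p" by (rule padic_cring[OF p])
  define I where "I = PIdl\<^bsub>padic_int_ring p\<^esub> (padic_of_int p (p ^ m))"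
  have pm: "padic_of_int p (p ^ m) \<in> carr p" by (rule padic_of_int_carr[OF p])
  have I: "z \<in> I \<longleftrightarrow> z \<in> carr p \<and> z m = 0" for z
  proof -
    have "z \<in> I \<longleftrightarrow> z \<in> carr p \<and> padic_of_int p (p ^ m) divides\<^bsub>padic_int_ring p\<^esub> z"
      using pm by (auto simp: I_def cgenideal_def factor_def m_comm)
    then show ?thesis using power_divides_iff[OF p] by blast
  qed
  have coset: "z \<in> I +>\<^bsub>padic_int_ring p\<^esub> x \<longleftrightarrow> z m = x m"
    if x: "x \<in> carr p" and z: "z \<in> carr p" for x z
  proof
    assume "z \<in> I +>\<^bsub>padic_int_ring p\<^esub> x"
    then obtain h where "h \<in> I" "z = h \<oplus>\<^bsub>padic_int_ring p\<^esub> x"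
      by (auto simp: a_r_coset_def')
    then show "z m = x m"
      using I carr_mod_self[OF x] by (simp add: ring_ops)
  next
    assume "z m = x m"
    then have "z \<ominus>\<^bsub>padic_int_ring p\<^esub> x \<in> I"
      using x z p by (simp add: I a_minus_entry)
    moreover have "z = (z \<ominus>\<^bsub>padic_int_ring p\<^esub> x) \<oplus>\<^bsub>padic_int_ring p\<^esub> x"
      using x z by (simp add: a_minus_def a_assoc l_neg)
    ultimately show "z \<in> I +>\<^bsub>padic_int_ring p\<^esub> x"
      by (auto simp: a_r_coset_def')
  qed
  have ex1: "\<exists>!u. u \<in> E \<and> u m = x m" if x: "x \<in> carr p" for x
  proof -
    have "I +>\<^bsub>padic_int_ring p\<^esub> x \<in> carrier (padic_int_ring p Quot I)"
      using x by (auto simp: FactRing_def A_RCOSETS_def')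
    then have "\<exists>!u. u \<in> E \<and> u \<in> I +>\<^bsub>padic_int_ring p\<^esub> x"
      using R by (simp add: residue_system_def I_def)
    moreover have "u \<in> E \<and> u \<in> I +>\<^bsub>padic_int_ring p\<^esub> x \<longleftrightarrow> u \<in> E \<and> u m = x m" for u
      using coset[OF x] E by blast
    ultimately show ?thesis by simp
  qed
  show ?thesis
    unfolding bij_betw_def
  proof (intro conjI inj_onI equalityI subsetI)
    fix u v assume "u \<in> E" "v \<in> E" "u m = v m"
    then show "u = v" using ex1[of v] E by blast
  next
    fix k assume "k \<in> (\<lambda>u. u m) ` E"
    then show "k \<in> {0..<p ^ m}" using E by (auto simp: mem_carr)
  next
    fix k assume k: "k \<in> {0..<p ^ m}"
    obtain u where "u \<in> E" "u m = padic_of_int p k m"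
      using ex1[OF padic_of_int_carr[OF p, of k]] by blast
    then show "k \<in> (\<lambda>u. u m) ` E" using k by (force simp: padic_of_int_def)
  qed
qed

theorem mainTheorem5:
  fixes p q :: int and m :: nat and E :: "(nat \<Rightarrow> int) set"
  assumes "Factorial_Ring.prime p"
    and "q > p" and "coprime q p"
    and "m > 0"
    and "E \<subseteq> rational_padic_ints p"
    and "residue_system p m E"
    and "\<And>u. u \<in> E \<Longrightarrow> rat_of_padic p u \<noteq> 0 \<and> H_padic p u > int m"
  shows "real m * ((real_of_int p - 1) / real_of_int p * (ln (real_of_int q) / ln (real_of_int p)) - 1) - 2
           \<le> mean_H_gain p q m E
       \<and> mean_H_gain p q m E
           \<le> real m * ((real_of_int p - 1) / real_of_int p * (ln (real_of_int q) / ln (real_of_int p)) - 1) + 2"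
proof -
  have p: "p > 0" using assms(1) by (simp add: prime_gt_0_int)
  define L where "L = ln (real_of_int q) / ln (real_of_int p)"
  define N where "N = real_of_int p ^ m"
  define D where "D u = real_of_int (H_padic p ((g_map p q ^^ m) u) - H_padic p u)" for u
  define k where "k u = real (mult_steps p q m (u m))" for u :: "nat \<Rightarrow> int"
  have bij: "bij_betw (\<lambda>u. u m) E {0..<p ^ m}"
    using residue_system_bij[OF p _ assms(6)] assms(5) by (auto simp: rational_padic_ints_def)
  have card: "real (card E) = N"
    using bij_betw_same_card[OF bij] p by (simp add: N_def)
  have N: "N > 0" using p by (simp add: N_def)
  have "sum k E = real (\<Sum>x\<in>{0..<p ^ m}. mult_steps p q m x)"
    using sum.reindex_bij_betw[OF bij, of "\<lambda>z. real (mult_steps p q m z)"] by (simp add: k_def)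
  then have sk: "sum k E = real m * ((real_of_int p - 1) / real_of_int p) * N"
    using sum_mult_steps[OF p assms(3), of m] p by (simp add: N_def field_simps)
  have D: "\<bar>D u - (k u * L - real m)\<bar> \<le> 2" if "u \<in> E" for u
    using H_gain_bound[OF assms(1,2), of u m] assms(5) assms(7)[OF that] that
    unfolding D_def k_def L_def by blast
  have "\<bar>sum D E - (sum k E * L - N * real m)\<bar> = \<bar>\<Sum>u\<in>E. D u - (k u * L - real m)\<bar>"
    by (simp add: sum_subtractf sum_distrib_right card)
  also have "\<dots> \<le> (\<Sum>u\<in>E. \<bar>D u - (k u * L - real m)\<bar>)"
    by (rule sum_abs)
  also have "\<dots> \<le> (\<Sum>u\<in>E. 2)"
    using D by (rule sum_mono)
  also have "\<dots> = 2 * N"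
    using card by simp
  finally have B: "\<bar>sum D E - (sum k E * L - N * real m)\<bar> \<le> 2 * N" .
  define M where "M = real m * ((real_of_int p - 1) / real_of_int p * L - 1)"
  have "sum k E * L - N * real m = M * N"
    by (simp add: sk M_def algebra_simps)
  then have "(M - 2) * N \<le> sum D E" "sum D E \<le> (M + 2) * N"
    using B by (auto simp: abs_le_iff algebra_simps)
  moreover have "mean_H_gain p q m E = sum D E / N"
    by (simp add: mean_H_gain_def D_def card)
  ultimately show ?thesis
    using N unfolding L_def[symmetric] M_def[symmetric] by (simp add: pos_le_divide_eq pos_divide_le_eq)
qed

end
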